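(* Let $S$ be a commutative ai-semiring and let $\Sigma$ be a set of inequalities that is an equational basis for $S$ and that contains an infinite subset of $\Omega=\{\sigma_n \mid n\geq 1\}$. If $\mathbf{u}^{(m)}$ is $\mathbf{t}$-free for every inequality $\mathbf{s}\preceq\mathbf{t}$ in $\Sigma\setminus\Omega$ and for every integer $m\geq 1$, then $S$ is nonfinitely based.
   Context: An ai-semiring is an algebra $(S,+,\cdot)$ such that $(S,+)$ is a commutative idempotent semigroup, $(S,\cdot)$ is a semigroup, and multiplication distributes over addition on both sides; it is commutative if $(S,\cdot)$ is commutative. Let $X$ be a countably infinite set of variables and $X_c^+$ the free commutative semigroup over $X$; its elements are called words. A term is a finite nonempty subset of $X_c^+$, written as a formal sum of its elements; a word is identified with the corresponding one-element term. The set $P_f(X_c^+)$ of all terms, with union as addition and elementwise product as multiplication, is the free commutative ai-semiring over $X$. A substitution is a semiring homomorphism $P_f(X_c^+)\to P_f(X_c^+)$. A term $\mathbf{u}$ is a subterm of a term $\mathbf{v}$ if $\mathbf{v}=\mathbf{p}_1\mathbf{u}+\mathbf{p}_2$ for some terms $\mathbf{p}_1,\mathbf{p}_2$, where $\mathbf{p}_1$ is also allowed to be the empty word (multiplicative identity) and $\mathbf{p}_2$ is also allowed to be the empty set (additive identity). The term $\mathbf{v}$ is $\mathbf{u}$-free if for every substitution $\varphi$, $\varphi(\mathbf{u})$ is not a subterm of $\mathbf{v}$. An identity is an expression $\mathbf{u}\approx\mathbf{v}$ with $\mathbf{u},\mathbf{v}$ terms; $S$ satisfies it if $\varphi(\mathbf{u})=\varphi(\mathbf{v})$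 for every semiring homomorphism $\varphi:P_f(X_c^+)\to S$. The inequality $\mathbf{s}\preceq\mathbf{t}$ denotes the identity $\mathbf{t}\approx\mathbf{t}+\mathbf{s}$. A set $\Sigma$ of identities is an equational basis for a commutative ai-semiring $S$ if the variety $\mathsf{V}(S)$ generated by $S$ is exactly the class of all commutative ai-semirings satisfying all identities in $\Sigma$. $S$ is nonfinitely based if $\mathsf{V}(S)$ cannot be defined by a finite set of identities. For $n\geq 1$, with pairwise distinct variables $x_1,\dots,x_{2n+1}$, put $\mathbf{q}^{(n)}=x_1x_2\cdots x_{2n+1}$ and $\mathbf{u}^{(n)}=x_1x_2+x_2x_3+\cdots+x_{2n}x_{2n+1}+x_{2n+1}x_1$, and let $\sigma_n$ denote the inequality $\mathbf{q}^{(n)}\preceq\mathbf{u}^{(n)}$. *)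

theory Defs
  imports "HOL-Library.Multiset" "HOL-Library.FuncSet"
begin

record 'a sr_alg =
  carrier :: "'a set"
  add :: "'a \<Rightarrow> 'a \<Rightarrow> 'a" (infixl \<open>\<oplus>\<index>\<close> 65)
  mult :: "'a \<Rightarrow> 'a \<Rightarrow> 'a" (infixl \<open>\<otimes>\<index>\<close> 70)

locale ai_semiring =
  fixes S :: "'a sr_alg" (structure)
  assumes nonempty: "carrier S \<noteq> {}"
    and add_closed: "\<lbrakk>a \<in> carrier S; b \<in> carrier S\<rbrakk> \<Longrightarrow> a \<oplus> b \<in> carrier S"
    and mult_closed: "\<lbrakk>a \<in> carrier S; b \<in> carrier S\<rbrakk> \<Longrightarrow> a \<otimes> b \<in> carrier S"
    and add_assoc: "\<lbrakk>a \<in> carrier S; b \<in> carrier S; c \<in> carrier S\<rbrakk>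
          \<Longrightarrow> (a \<oplus> b) \<oplus> c = a \<oplus> (b \<oplus> c)"
    and add_comm: "\<lbrakk>a \<in> carrier S; b \<in> carrier S\<rbrakk> \<Longrightarrow> a \<oplus> b = b \<oplus> a"
    and add_idem: "a \<in> carrier S \<Longrightarrow> a \<oplus> a = a"
    and mult_assoc: "\<lbrakk>a \<in> carrier S; b \<in> carrier S; c \<in> carrier S\<rbrakk>
          \<Longrightarrow> (a \<otimes> b) \<otimes> c = a \<otimes> (b \<otimes> c)"
    and distrib_left: "\<lbrakk>a \<in> carrier S; b \<in> carrier S; c \<in> carrier S\<rbrakk>
          \<Longrightarrow> a \<otimes> (b \<oplus> c) = (a \<otimes> b) \<oplus> (a \<otimes> c)"
    and distrib_right: "\<lbrakk>a \<in> carrier S; b \<in> carrier S; c \<in> carrier S\<rbrakk>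
          \<Longrightarrow> (a \<oplus> b) \<otimes> c = (a \<otimes> c) \<oplus> (b \<otimes> c)"

locale comm_ai_semiring = ai_semiring +
  assumes mult_comm: "\<lbrakk>a \<in> carrier S; b \<in> carrier S\<rbrakk> \<Longrightarrow> a \<otimes> b = b \<otimes> a"

definition hom :: "'a sr_alg \<Rightarrow> 'b sr_alg \<Rightarrow> ('a \<Rightarrow> 'b) set" where
  "hom S T = {\<phi> \<in> carrier S \<rightarrow> carrier T. \<forall>a \<in> carrier S. \<forall>b \<in> carrier S.
     \<phi> (a \<oplus>\<^bsub>S\<^esub> b) = \<phi> a \<oplus>\<^bsub>T\<^esub> \<phi> b \<and> \<phi> (a \<otimes>\<^bsub>S\<^esub> b) = \<phi> a \<otimes>\<^bsub>T\<^esub> \<phi> b}"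


section \<open>Terms and identities\<close>

text \<open>The variables are the natural numbers.  A word is a nonempty multiset of variables
  (multiset sum is the product of words); the empty multiset is the empty word, which is
  not itself a word of the free commutative semigroup.\<close>

type_synonym word = "nat multiset"

definition words :: "word set" where
  "words = {w. w \<noteq> {#}}"

definition terms :: "word set set" where
  "terms = {t. t \<subseteq> words \<and> finite t \<and> t \<noteq> {}}"

definition term_mult :: "word set \<Rightarrow> word set \<Rightarrow> word set" where
  "term_mult s t = {v + w | v w. v \<in> s \<and> w \<in> t}"

definition term_alg :: "word set sr_alg" where
  "term_alg = \<lparr>carrier = terms, add = (\<union>), mult = term_mult\<rparr>"

definition subterm :: "word set \<Rightarrow> word set \<Rightarrow> bool" where
  "subterm u v \<longleftrightarrow> (\<exists>p1 p2. (p1 \<in> terms \<or> p1 = {{#}}) \<and> (p2 \<in> terms \<or> p2 = {}) \<and>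
     v = term_mult p1 u \<union> p2)"

text \<open>\<open>is_free u v\<close>: the term \<open>v\<close> is \<open>u\<close>-free.\<close>

definition is_free :: "word set \<Rightarrow> word set \<Rightarrow> bool" where
  "is_free u v \<longleftrightarrow> (\<forall>\<phi> \<in> hom term_alg term_alg. \<not> subterm (\<phi> u) v)"

type_synonym identity = "word set \<times> word set"

definition identities :: "identity set" where
  "identities = terms \<times> terms"

definition satisfies :: "'a sr_alg \<Rightarrow> identity \<Rightarrow> bool" where
  "satisfies S e \<longleftrightarrow> (\<forall>\<phi> \<in> hom term_alg S. \<phi> (fst e) = \<phi> (snd e))"

definition inequality :: "word set \<Rightarrow> word set \<Rightarrow> identity" (infix \<open>\<preceq>\<close> 50) where
  "s \<preceq> t = (t, t \<union> s)"

definition inequalities :: "identity set" where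
  "inequalities = {s \<preceq> t | s t. s \<in> terms \<and> t \<in> terms}"


section \<open>Generated varieties and equational bases\<close>

definition direct_power :: "'i set \<Rightarrow> 'a sr_alg \<Rightarrow> ('i \<Rightarrow> 'a) sr_alg" where
  "direct_power I S = \<lparr>carrier = I \<rightarrow>\<^sub>E carrier S,
     add = (\<lambda>f g. \<lambda>i\<in>I. f i \<oplus>\<^bsub>S\<^esub> g i), mult = (\<lambda>f g. \<lambda>i\<in>I. f i \<otimes>\<^bsub>S\<^esub> g i)\<rparr>"

definition subalgebra :: "'a set \<Rightarrow> 'a sr_alg \<Rightarrow> bool" where
  "subalgebra A S \<longleftrightarrow> A \<subseteq> carrier S \<and> A \<noteq> {} \<and>
     (\<forall>a \<in> A. \<forall>b \<in> A. a \<oplus>\<^bsub>S\<^esub> b \<in> A \<and> a \<otimes>\<^bsub>S\<^esub> b \<in> A)"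

text \<open>The variety generated by \<open>S\<close> consists of the homomorphic images of subalgebras of
  direct powers of \<open>S\<close>.  For an algebra with carrier in \<open>'b\<close> it is no restriction to index the
  power by a set of functions \<open>'b \<Rightarrow> 'a\<close>: see \<open>in_varietyI\<close> below, where the index type
  is arbitrary.\<close>

definition in_variety :: "'b sr_alg \<Rightarrow> 'a sr_alg \<Rightarrow> bool" where
  "in_variety T S \<longleftrightarrow> (\<exists>(I :: ('b \<Rightarrow> 'a) set) A h. subalgebra A (direct_power I S) \<and>
     h \<in> hom ((direct_power I S)\<lparr>carrier := A\<rparr>) T \<and> h ` A = carrier T)"

lemma in_varietyI:
  fixes S :: "'a sr_alg" and T :: "'b sr_alg" and J :: "'j set"
  assumes sub: "subalgebra A (direct_power J S)"
    and h: "h \<in> hom ((direct_power J S)\<lparr>carrier := A\<rparr>) T" and onto: "h ` A = carrier T"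
  shows "in_variety T S"
proof -
  define p where "p t = (SOME a. a \<in> A \<and> h a = t)" for t
  have p: "p t \<in> A \<and> h (p t) = t" if "t \<in> carrier T" for t
  proof -
    have "t \<in> h ` A" using that by (simp add: onto)
    then obtain a where "t = h a" "a \<in> A" by (rule imageE)
    then have "a \<in> A \<and> h a = t" by simp
    then show ?thesis unfolding p_def by (rule someI[of "\<lambda>a. a \<in> A \<and> h a = t"])
  qed
  define g where "g i = (\<lambda>t. if t \<in> carrier T then p t i else undefined)" for i
  define I where "I = g ` J"
  define c where "c f = (\<lambda>i\<in>J. f (g i))" for f :: "('b \<Rightarrow> 'a) \<Rightarrow> 'a"
  define B where "B = {f \<in> I \<rightarrow>\<^sub>E carrier S. c f \<in> A}"
  have AJ: "A \<subseteq> J \<rightarrow>\<^sub>E carrier S"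
    using sub by (auto simp: subalgebra_def direct_power_def)
  have p_ev: "\<exists>f \<in> B. c f = p t" if t: "t \<in> carrier T" for t
  proof -
    have pJ: "p t \<in> J \<rightarrow>\<^sub>E carrier S" using p[OF t] AJ by blast
    define f where "f = (\<lambda>k\<in>I. k t)"
    have "c f = p t"
    proof
      fix i
      show "c f i = p t i"
      proof (cases "i \<in> J")
        case True
        then show ?thesis using t by (simp add: c_def f_def I_def g_def)
      next
        case False
        then show ?thesis using PiE_arb[OF pJ False] by (simp add: c_def)
      qed
    qed
    moreover have "f \<in> I \<rightarrow>\<^sub>E carrier S"
    proof (rule PiE_I)
      fix k assume "k \<in> I"
      then show "f k \<in> carrier S"
        using PiE_mem[OF pJ] t by (auto simp: f_def I_def g_def)
    qed (simp add: f_def)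
    ultimately show ?thesis using p[OF t] by (auto simp: B_def)
  qed
  have I: "g i \<in> I" if "i \<in> J" for i using that by (simp add: I_def)
  have c_add: "c (f \<oplus>\<^bsub>direct_power I S\<^esub> f') = c f \<oplus>\<^bsub>direct_power J S\<^esub> c f'" for f f'
    by (rule ext) (simp add: c_def direct_power_def I)
  have c_mult: "c (f \<otimes>\<^bsub>direct_power I S\<^esub> f') = c f \<otimes>\<^bsub>direct_power J S\<^esub> c f'" for f f'
    by (rule ext) (simp add: c_def direct_power_def I)
  have B_I: "f \<in> B" if "f \<in> extensional I" "c f \<in> A" for f
  proof -
    have "f k \<in> carrier S" if "k \<in> I" for k
    proof -
      obtain i where i: "i \<in> J" "k = g i" using \<open>k \<in> I\<close> unfolding I_def by blast
      then show ?thesis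
        using PiE_mem[OF subsetD[OF AJ \<open>c f \<in> A\<close>] i(1)] by (simp add: c_def)
    qed
    then show ?thesis using that by (simp add: B_def PiE_def)
  qed
  have cl: "f \<oplus>\<^bsub>direct_power I S\<^esub> f' \<in> B \<and> f \<otimes>\<^bsub>direct_power I S\<^esub> f' \<in> B"
    if f: "f \<in> B" "f' \<in> B" for f f'
  proof -
    have "c f \<in> A" "c f' \<in> A" using f by (simp_all add: B_def)
    then have "c f \<oplus>\<^bsub>direct_power J S\<^esub> c f' \<in> A" "c f \<otimes>\<^bsub>direct_power J S\<^esub> c f' \<in> A"
      using sub by (simp_all add: subalgebra_def)
    moreover have "f \<oplus>\<^bsub>direct_power I S\<^esub> f' \<in> extensional I"
        "f \<otimes>\<^bsub>direct_power I S\<^esub> f' \<in> extensional I"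
      by (simp_all add: direct_power_def)
    ultimately show ?thesis by (simp add: B_I c_add c_mult)
  qed
  have ne: "carrier T \<noteq> {}" using sub onto by (auto simp: subalgebra_def)
  have "B \<noteq> {}" using ne p_ev by blast
  moreover have "B \<subseteq> carrier (direct_power I S)" by (auto simp: B_def direct_power_def)
  ultimately have sB: "subalgebra B (direct_power I S)"
    using cl by (simp add: subalgebra_def)
  have cB: "c f \<in> A" if "f \<in> B" for f using that by (simp add: B_def)
  have hB: "h \<circ> c \<in> hom ((direct_power I S)\<lparr>carrier := B\<rparr>) T"
    using h cB by (simp add: hom_def c_add c_mult Pi_iff)
  have "t \<in> (h \<circ> c) ` B" if t: "t \<in> carrier T" for t
  proof -
    obtain f where "f \<in> B" "c f = p t" using p_ev[OF t] by blast
    then show ?thesis using p[OF t] by (intro image_eqI[of _ _ f]) simp_all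
  qed
  moreover have "(h \<circ> c) f \<in> carrier T" if "f \<in> B" for f
    using cB[OF that] onto by auto
  ultimately have "(h \<circ> c) ` B = carrier T" by blast
  then show ?thesis unfolding in_variety_def using sB hB by blast
qed

text \<open>A statement in HOL cannot quantify over algebras of all types.  The argument
  \<open>TYPE('b)\<close> fixes a type \<open>'b\<close> in which carriers are taken; the notions do not depend on it
  as long as it is infinite, since varieties are determined by their countable members.\<close>

definition equational_basis :: "'b itself \<Rightarrow> 'a sr_alg \<Rightarrow> identity set \<Rightarrow> bool" where
  "equational_basis (U :: 'b itself) S \<Sigma> \<longleftrightarrow> \<Sigma> \<subseteq> identities \<and>
     (\<forall>T :: 'b sr_alg. in_variety T S \<longleftrightarrow> comm_ai_semiring T \<and> (\<forall>e \<in> \<Sigma>. satisfies T e))"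

definition nonfinitely_based :: "'b itself \<Rightarrow> 'a sr_alg \<Rightarrow> bool" where
  "nonfinitely_based (U :: 'b itself) S \<longleftrightarrow> \<not> (\<exists>\<Gamma>. finite \<Gamma> \<and> equational_basis U S \<Gamma>)"


section \<open>The inequalities of odd cycles\<close>

definition q_term :: "nat \<Rightarrow> word set" where
  "q_term n = {mset_set {1..2 * n + 1}}"

definition u_term :: "nat \<Rightarrow> word set" where
  "u_term n = {{#i, i + 1#} | i. i \<in> {1..2 * n}} \<union> {{#2 * n + 1, 1#}}"

definition sigma :: "nat \<Rightarrow> identity" where
  "sigma n = (q_term n \<preceq> u_term n)"

definition Omega :: "identity set" where
  "Omega = {sigma n | n. n \<ge> 1}"

end

theory Submission
  imports Defs "HOL-Library.Set_Algebras" "HOL-Library.Countable_Set"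
begin

text \<open>Everything is reduced to derivations between terms. For a set \<open>E\<close> of identities let
  \<open>derives E\<close> be the equivalence relation generated by the steps
  \<open>p \<phi>(a) + q \<rightarrow> p \<phi>(b) + q\<close> with \<open>(a, b) \<in> E\<close> and a substitution \<open>\<phi>\<close>. It is a fully
  invariant congruence, so the quotient of the term algebra by it is a model of \<open>E\<close> that satisfies
  only the derivable identities (\<open>ex_model_satisfying_exactly_derivable\<close>). There are only
  countably many terms, so this model can be placed in any infinite type. It is therefore among
  the algebras whose membership in the variety is decided by a basis.

  Suppose that a finite \<open>\<Gamma>\<close> is also a basis. The quotient model of \<open>\<Sigma>\<close> satisfies \<open>\<Gamma>\<close>, so
  \<open>\<Sigma>\<close> derives all of \<open>\<Gamma>\<close>. A derivation is a finite object, so a finite \<open>F \<subseteq> \<Sigma>\<close> suffices.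
  The quotient model of \<open>F\<close> then satisfies \<open>\<Gamma>\<close>, hence \<open>\<Sigma>\<close>, and therefore \<open>F\<close> derives all of
  \<open>\<Sigma>\<close>, in particular infinitely many inequalities \<open>sigma n\<close>.

  This fails once \<open>n\<close> exceeds every \<open>k\<close> with \<open>sigma k \<in> F\<close>. No derivation can leave a term that
  contains no substitution instance of a left-hand side (\<open>derives_isolated\<close>), and \<open>u_term n\<close> is
  such a term for \<open>F\<close>: for members outside \<open>Omega\<close> this is the hypothesis, and for \<open>sigma k\<close> an
  instance of \<open>u_term k\<close> inside \<open>u_term n\<close> would be a graph homomorphism from the cycle of length
  \<open>2 k + 1\<close> to the longer odd cycle of length \<open>2 n + 1\<close>, which does not exist
  (\<open>u_term_free_of_shorter\<close>).\<close>


section \<open>The algebra of terms\<close>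

notation term_mult (infixl \<open>\<odot>\<close> 70)

lemma term_mult_eq_plus: "s \<odot> t = s + t"
  by (auto simp: term_mult_def set_plus_def)

lemma term_mult_assoc: "(a \<odot> b) \<odot> c = a \<odot> (b \<odot> c)"
  by (simp add: term_mult_eq_plus add.assoc)

lemma term_mult_comm: "a \<odot> b = b \<odot> a"
  by (simp add: term_mult_eq_plus add.commute)

lemma term_mult_Un: "a \<odot> (b \<union> c) = a \<odot> b \<union> a \<odot> c" "(a \<union> b) \<odot> c = a \<odot> c \<union> b \<odot> c"
  by (auto simp: term_mult_def)

lemma term_mult_UN: "a \<odot> b = (\<Union>v \<in> a. (\<lambda>w. v + w) ` b)"
  by (auto simp: term_mult_def)

lemma UN_term_mult: "(\<Union>x \<in> A. f x) \<odot> (\<Union>y \<in> B. g y) = (\<Union>x \<in> A. \<Union>y \<in> B. f x \<odot> g y)"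
  by (simp add: term_mult_UN image_UN) blast

lemma term_mult_empty_word [simp]: "{{#}} \<odot> a = a" "a \<odot> {{#}} = a"
  by (auto simp: term_mult_def)

lemma term_mult_empty [simp]: "a \<odot> {} = {}" "{} \<odot> a = {}"
  by (auto simp: term_mult_def)

lemma term_mult_singleton [simp]: "{v} \<odot> {w} = {v + w}"
  by (auto simp: term_mult_def)

lemma term_mult_closed [simp]: "a \<in> terms \<Longrightarrow> b \<in> terms \<Longrightarrow> a \<odot> b \<in> terms"
  by (auto simp: terms_def words_def term_mult_eq_plus set_plus_image)

lemma Un_closed [simp]: "a \<in> terms \<Longrightarrow> b \<in> terms \<Longrightarrow> a \<union> b \<in> terms"
  by (auto simp: terms_def)

lemma countable_terms: "countable terms"
proof -
  have "countable (range mset :: word set)" by simp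
  then have "countable {t :: word set. finite t \<and> t \<subseteq> range mset}"
    by (rule countable_Collect_finite_subset)
  moreover have "terms \<subseteq> {t. finite t \<and> t \<subseteq> range mset}"
    by (auto simp: terms_def) (metis ex_mset rangeI)
  ultimately show ?thesis by (rule countable_subset[rotated])
qed

lemma carrier_term_alg [simp]: "carrier term_alg = terms"
  by (simp add: term_alg_def)

lemma hom_term_algI:
  assumes "\<And>a. a \<in> terms \<Longrightarrow> \<phi> a \<in> carrier T"
    and "\<And>a b. a \<in> terms \<Longrightarrow> b \<in> terms \<Longrightarrow> \<phi> (a \<union> b) = \<phi> a \<oplus>\<^bsub>T\<^esub> \<phi> b"
    and "\<And>a b. a \<in> terms \<Longrightarrow> b \<in> terms \<Longrightarrow> \<phi> (a \<odot> b) = \<phi> a \<otimes>\<^bsub>T\<^esub> \<phi> b"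
  shows "\<phi> \<in> hom term_alg T"
  using assms by (simp add: hom_def term_alg_def)

lemma hom_term_algD:
  assumes "\<phi> \<in> hom term_alg T" "a \<in> terms"
  shows "\<phi> a \<in> carrier T"
    and "b \<in> terms \<Longrightarrow> \<phi> (a \<union> b) = \<phi> a \<oplus>\<^bsub>T\<^esub> \<phi> b"
    and "b \<in> terms \<Longrightarrow> \<phi> (a \<odot> b) = \<phi> a \<otimes>\<^bsub>T\<^esub> \<phi> b"
  using assms by (auto simp: hom_def term_alg_def)

lemma substD:
  assumes "\<phi> \<in> hom term_alg term_alg" "a \<in> terms"
  shows "\<phi> a \<in> terms"
    and "b \<in> terms \<Longrightarrow> \<phi> (a \<union> b) = \<phi> a \<union> \<phi> b"
    and "b \<in> terms \<Longrightarrow> \<phi> (a \<odot> b) = \<phi> a \<odot> \<phi> b"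
  using hom_term_algD[OF assms] by (simp_all add: term_alg_def)

lemma subst_mono:
  assumes "\<phi> \<in> hom term_alg term_alg" "a \<in> terms" "b \<in> terms" "a \<subseteq> b"
  shows "\<phi> a \<subseteq> \<phi> b"
  using substD(2)[OF assms(1-3)] assms(4) by (simp add: Un_absorb1) blast

lemma subst_comp:
  assumes "\<phi> \<in> hom term_alg term_alg" "\<psi> \<in> hom term_alg term_alg"
  shows "(\<lambda>a. \<psi> (\<phi> a)) \<in> hom term_alg term_alg"
  using substD[OF assms(1)] substD[OF assms(2)]
  by (intro hom_term_algI) (simp_all add: term_alg_def)

lemma subst_id: "(\<lambda>a. a) \<in> hom term_alg term_alg"
  by (intro hom_term_algI) (simp_all add: term_alg_def)


section \<open>Freeness of the term algebra\<close>

text \<open>A term is a finite sum of products of variables, so it can be reached from the variables by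
  the two operations.\<close>

lemma terms_induct [consumes 1, case_names var add mult]:
  assumes "t \<in> terms"
    and var: "\<And>i. P {{#i#}}"
    and add: "\<And>a b. a \<in> terms \<Longrightarrow> b \<in> terms \<Longrightarrow> P a \<Longrightarrow> P b \<Longrightarrow> P (a \<union> b)"
    and mult: "\<And>a b. a \<in> terms \<Longrightarrow> b \<in> terms \<Longrightarrow> P a \<Longrightarrow> P b \<Longrightarrow> P (a \<odot> b)"
  shows "P t"
proof -
  have word: "P {w}" if "w \<noteq> {#}" for w
    using that
  proof (induction w)
    case (add i w)
    show ?case
    proof (cases "w = {#}")
      case False
      then have "P ({{#i#}} \<odot> {w})"
        by (intro mult var add.IH) (auto simp: terms_def words_def)
      then show ?thesis by simp
    qed (simp add: var)
  qed simp
  have "finite t" "t \<noteq> {}" "t \<subseteq> words" using assms(1) by (auto simp: terms_def)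
  then show ?thesis
  proof (induction t rule: finite_ne_induct)
    case (insert w t)
    then have "P ({w} \<union> t)"
      by (intro add word) (auto simp: terms_def words_def)
    then show ?case by simp
  qed (auto simp: words_def intro: word)
qed

lemma hom_eqI:
  assumes "\<phi> \<in> hom term_alg T" "\<psi> \<in> hom term_alg T"
    and "\<And>i. \<phi> {{#i#}} = \<psi> {{#i#}}" and "t \<in> terms"
  shows "\<phi> t = \<psi> t"
  using assms(4)
  by (induction rule: terms_induct) (simp_all add: assms(3) hom_term_algD[OF assms(1)] hom_term_algD[OF assms(2)])

text \<open>Replacing the variable \<open>i\<close> by \<open>v i\<close> turns a word into an iterated product of sets of words,
  which is a sum over the multiset for the elementwise addition of sets.\<close>

definition extend :: "(nat \<Rightarrow> word set) \<Rightarrow> word set \<Rightarrow> word set" where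
  "extend v t = (\<Union>w \<in> t. \<Sum>i \<in># w. v i)"

lemma extend_var [simp]: "extend v {{#i#}} = v i"
  by (simp add: extend_def)

lemma extend_hom:
  assumes v: "\<And>i. v i \<in> terms"
  shows "extend v \<in> hom term_alg term_alg"
proof -
  have mult: "extend v (a \<odot> b) = extend v a \<odot> extend v b" for a b
  proof -
    have "extend v (a \<odot> b) = (\<Union>x \<in> a. \<Union>y \<in> b. (\<Sum>i \<in># x. v i) \<odot> (\<Sum>i \<in># y. v i))"
      unfolding extend_def term_mult_UN[of a b] by (simp add: term_mult_eq_plus)
    also have "\<dots> = extend v a \<odot> extend v b"
      by (simp only: extend_def UN_term_mult)
    finally show ?thesis .
  qed
  have add: "extend v (a \<union> b) = extend v a \<union> extend v b" for a b
    by (auto simp: extend_def)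
  have "extend v a \<in> terms" if "a \<in> terms" for a
    using that by (induction rule: terms_induct) (simp_all add: v mult add)
  then show ?thesis
    by (intro hom_term_algI) (simp_all add: term_alg_def mult add[unfolded term_alg_def])
qed


section \<open>Derivations\<close>

text \<open>The factor \<open>p\<close> may be the empty word and the summand \<open>q\<close> may be the empty sum.\<close>

inductive derives :: "identity set \<Rightarrow> word set \<Rightarrow> word set \<Rightarrow> bool" for E where
  step: "\<lbrakk>(a, b) \<in> E; \<phi> \<in> hom term_alg term_alg; p \<in> insert {{#}} terms; q \<in> insert {} terms\<rbrakk>
    \<Longrightarrow> derives E (p \<odot> \<phi> a \<union> q) (p \<odot> \<phi> b \<union> q)"
| refl: "a \<in> terms \<Longrightarrow> derives E a a"
| sym: "derives E a b \<Longrightarrow> derives E b a"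
| trans: "\<lbrakk>derives E a b; derives E b c\<rbrakk> \<Longrightarrow> derives E a c"

lemma derives_axiom:
  assumes "(a, b) \<in> E"
  shows "derives E a b"
  using step[OF assms subst_id, of "{{#}}" "{}"] by simp

text \<open>A context around a step is absorbed into the factor and the summand of that step.\<close>

lemma derives_context:
  assumes "derives E a b" "r \<in> insert {{#}} terms" "s \<in> insert {} terms"
  shows "derives E (r \<odot> a \<union> s) (r \<odot> b \<union> s)"
  using assms(1)
proof induction
  case (step a b \<phi> p q)
  have "r \<odot> p \<in> insert {{#}} terms" "r \<odot> q \<union> s \<in> insert {} terms"
    using step(3,4) assms(2,3) by auto
  from derives.step[OF step(1,2) this] show ?case
    by (simp add: term_mult_Un term_mult_assoc Un_assoc)
next
  case (refl a)
  then show ?case using assms(2,3) by (intro derives.refl) auto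
qed (blast intro: derives.sym derives.trans)+

lemma derives_add:
  assumes "derives E a a'" "derives E b b'" "b \<in> terms" "a' \<in> terms"
  shows "derives E (a \<union> b) (a' \<union> b')"
proof -
  have "derives E (a \<union> b) (a' \<union> b)"
    using derives_context[OF assms(1), of "{{#}}" b] assms(3) by simp
  moreover have "derives E (b \<union> a') (b' \<union> a')"
    using derives_context[OF assms(2), of "{{#}}" a'] assms(4) by simp
  ultimately show ?thesis by (metis derives.trans Un_commute)
qed

lemma derives_mult:
  assumes "derives E a a'" "derives E b b'" "b \<in> terms" "a' \<in> terms"
  shows "derives E (a \<odot> b) (a' \<odot> b')"
proof -
  have "derives E (b \<odot> a) (b \<odot> a')"
    using derives_context[OF assms(1), of b "{}"] assms(3) by simp
  moreover have "derives E (a' \<odot> b) (a' \<odot> b')"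
    using derives_context[OF assms(2), of a' "{}"] assms(4) by simp
  ultimately show ?thesis by (metis derives.trans term_mult_comm)
qed

lemma derives_subst:
  assumes E: "E \<subseteq> identities" and "derives E a b" and \<psi>: "\<psi> \<in> hom term_alg term_alg"
  shows "derives E (\<psi> a) (\<psi> b)"
  using assms(2)
proof induction
  case (step a b \<phi> p q)
  \<comment> \<open>A substitution has no meaning on the empty word and the empty sum, which are to be kept.\<close>
  define p' where "p' = (if p = {{#}} then p else \<psi> p)"
  define q' where "q' = (if q = {} then q else \<psi> q)"
  have p': "p' \<in> insert {{#}} terms" and q': "q' \<in> insert {} terms"
    using step(3,4) substD(1)[OF \<psi>] by (auto simp: p'_def q'_def)
  have "\<psi> (p \<odot> \<phi> c \<union> q) = p' \<odot> \<psi> (\<phi> c) \<union> q'" if "c \<in> terms" for c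
    using step(3,4) substD(1)[OF step(2) that] substD[OF \<psi>]
    by (auto simp: p'_def q'_def)
  moreover have "a \<in> terms" "b \<in> terms" using step(1) E by (auto simp: identities_def)
  ultimately show ?case
    using derives.step[OF step(1) subst_comp[OF step(2) \<psi>] p' q'] by simp
next
  case (refl a)
  then show ?case by (intro derives.refl substD(1)[OF \<psi>])
qed (blast intro: derives.sym derives.trans)+

lemma derives_mono:
  assumes "derives E a b" "E \<subseteq> F"
  shows "derives F a b"
  using assms(1)
  by induction (use assms(2) in \<open>blast intro: derives.intros\<close>)+

lemma derives_finite:
  assumes "derives E a b"
  shows "\<exists>F \<subseteq> E. finite F \<and> derives F a b"
  using assms
proof induction
  case (step a b \<phi> p q)
  have "derives {(a, b)} (p \<odot> \<phi> a \<union> q) (p \<odot> \<phi> b \<union> q)"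
    using step by (intro derives.step) auto
  then show ?case using step(1) by (intro exI[of _ "{(a, b)}"]) simp
next
  case (refl a)
  then show ?case using derives.refl[of a "{}"] by blast
next
  case (sym a b)
  then show ?case using derives.sym by blast
next
  case (trans a b c)
  then obtain F G where "F \<subseteq> E" "finite F" "derives F a b" "G \<subseteq> E" "finite G" "derives G b c"
    by blast
  then show ?case
    by (intro exI[of _ "F \<union> G"]) (auto intro: derives.trans derives_mono)
qed

text \<open>A step that starts or ends at \<open>u\<close> exhibits an instance of \<open>t\<close> in \<open>u\<close>: both sides of
  an inequality contain \<open>t\<close>, and the instance of the extra summand \<open>s\<close> goes into the remainder of
  the subterm decomposition.\<close>

lemma derives_isolated:
  assumes E: "\<And>e. e \<in> E \<Longrightarrow> \<exists>s \<in> terms. \<exists>t \<in> terms. e = (s \<preceq> t) \<and> is_free t u"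
    and "derives E a b"
  shows "a = u \<longleftrightarrow> b = u"
  using assms(2)
proof induction
  case (step a b \<phi> p q)
  obtain s where s: "s \<in> terms" and a: "a \<in> terms" and b: "b = a \<union> s" and free: "is_free a u"
    using E[OF step(1)] by (auto simp: inequality_def)
  have *: "p \<odot> \<phi> a \<union> q' \<noteq> u" if "q' \<in> insert {} terms" for q'
    using free step(2,3) that unfolding is_free_def subterm_def by blast
  have "p \<odot> \<phi> b \<union> q = p \<odot> \<phi> a \<union> (p \<odot> \<phi> s \<union> q)"
    using substD(2)[OF step(2) a s] by (simp add: b term_mult_Un Un_assoc)
  moreover have "p \<odot> \<phi> s \<union> q \<in> insert {} terms"
    using step(3,4) substD(1)[OF step(2) s] by auto
  ultimately show ?case using * step(4) by metis
qed auto


section \<open>The quotient model\<close>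

text \<open>The classes of derivability are represented by chosen terms, which are numbered and then
  placed in the infinite type. A homomorphism into the quotient lifts to a substitution
  because the term algebra is free; this makes satisfaction in the quotient the same as
  derivability.\<close>

lemma ex_model_satisfying_exactly_derivable:
  assumes inf: "infinite (UNIV :: 'b set)" and E: "E \<subseteq> identities"
  shows "\<exists>T :: 'b sr_alg. comm_ai_semiring T \<and>
    (\<forall>a \<in> terms. \<forall>b \<in> terms. satisfies T (a, b) \<longleftrightarrow> derives E a b)"
proof -
  obtain f :: "nat \<Rightarrow> 'b" where f: "inj f"
    using infinite_countable_subset[OF inf] by blast
  define rep where "rep a = (SOME b. b \<in> terms \<and> derives E a b)" for a
  have rep: "rep a \<in> terms" "derives E a (rep a)" if "a \<in> terms" for a
    using someI[of "\<lambda>b. b \<in> terms \<and> derives E a b" a] that derives.refl[OF that]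
    by (auto simp: rep_def)
  have rep_eq: "rep a = rep b \<longleftrightarrow> derives E a b" if "a \<in> terms" "b \<in> terms" for a b
  proof
    assume "rep a = rep b"
    then show "derives E a b" using rep that by (metis derives.sym derives.trans)
  next
    assume "derives E a b"
    then have "derives E a = derives E b" by (intro ext) (blast intro: derives.sym derives.trans)
    then show "rep a = rep b" by (simp add: rep_def)
  qed
  define \<kappa> where "\<kappa> a = f (to_nat_on terms (rep a))" for a
  have \<kappa>_eq: "\<kappa> a = \<kappa> b \<longleftrightarrow> derives E a b" if "a \<in> terms" "b \<in> terms" for a b
    using inj_on_to_nat_on[OF countable_terms] rep(1) that
    by (simp add: \<kappa>_def inj_eq[OF f] inj_on_eq_iff rep_eq)
  define \<rho> where "\<rho> = inv_into terms \<kappa>"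
  have \<rho>: "\<rho> x \<in> terms" "\<kappa> (\<rho> x) = x" if "x \<in> \<kappa> ` terms" for x
    using that by (simp_all add: \<rho>_def inv_into_into f_inv_into_f)
  define T where "T = \<lparr>carrier = \<kappa> ` terms, add = (\<lambda>x y. \<kappa> (\<rho> x \<union> \<rho> y)),
    mult = (\<lambda>x y. \<kappa> (\<rho> x \<odot> \<rho> y))\<rparr>"
  have \<rho>\<kappa>: "\<rho> (\<kappa> a) \<in> terms" "derives E (\<rho> (\<kappa> a)) a" if "a \<in> terms" for a
    using \<rho>[of "\<kappa> a"] \<kappa>_eq[of "\<rho> (\<kappa> a)" a] that by simp_all
  have carr: "carrier T = \<kappa> ` terms" by (simp add: T_def)
  have add: "\<kappa> a \<oplus>\<^bsub>T\<^esub> \<kappa> b = \<kappa> (a \<union> b)" if "a \<in> terms" "b \<in> terms" for a b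
    using that by (simp add: T_def \<kappa>_eq \<rho>\<kappa>(1)) (simp add: derives_add \<rho>\<kappa>)
  have mult: "\<kappa> a \<otimes>\<^bsub>T\<^esub> \<kappa> b = \<kappa> (a \<odot> b)" if "a \<in> terms" "b \<in> terms" for a b
    using that by (simp add: T_def \<kappa>_eq \<rho>\<kappa>(1)) (simp add: derives_mult \<rho>\<kappa>)
  have \<kappa>_hom: "\<kappa> \<in> hom term_alg T"
    by (rule hom_term_algI) (simp_all add: carr add mult)
  have comm: "\<kappa> (a \<union> b) = \<kappa> (b \<union> a)" "\<kappa> (a \<odot> b) = \<kappa> (b \<odot> a)" for a b
    by (simp_all only: Un_commute term_mult_comm)
  have "{{#0#}} \<in> terms" by (simp add: terms_def words_def)
  then have "comm_ai_semiring T"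
    by unfold_locales
      (auto simp: carr add mult term_mult_Un term_mult_assoc Un_assoc intro: comm)
  moreover have "satisfies T (a, b) \<longleftrightarrow> derives E a b" if ab: "a \<in> terms" "b \<in> terms" for a b
  proof
    assume "satisfies T (a, b)"
    then show "derives E a b" using \<kappa>_hom ab by (auto simp: satisfies_def \<kappa>_eq)
  next
    assume der: "derives E a b"
    have "\<phi> a = \<phi> b" if \<phi>: "\<phi> \<in> hom term_alg T" for \<phi>
    proof -
      define v where "v i = \<rho> (\<phi> {{#i#}})" for i
      have "\<phi> {{#i#}} \<in> \<kappa> ` terms" for i
        using hom_term_algD(1)[OF \<phi>, of "{{#i#}}"] by (simp add: carr terms_def words_def)
      then have v: "v i \<in> terms" "\<kappa> (v i) = \<phi> {{#i#}}" for i
        by (simp_all add: v_def \<rho>)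
      note ext = substD[OF extend_hom[of v, OF v(1)]]
      have "(\<lambda>t. \<kappa> (extend v t)) \<in> hom term_alg T"
        by (rule hom_term_algI) (simp_all add: carr add mult ext)
      then have lift: "\<phi> t = \<kappa> (extend v t)" if "t \<in> terms" for t
        by (rule hom_eqI[OF \<phi> _ _ that]) (simp_all add: v(2))
      have "derives E (extend v a) (extend v b)"
        using derives_subst[OF E der extend_hom[of v, OF v(1)]] .
      then show ?thesis using ab by (simp add: lift \<kappa>_eq ext)
    qed
    then show "satisfies T (a, b)" by (simp add: satisfies_def)
  qed
  ultimately show ?thesis by blast
qed

text \<open>Completeness in the form in which two bases of one variety are compared: if every model of \<open>E\<close>
  is a model of \<open>F\<close>, then whatever derives \<open>E\<close> derives \<open>F\<close>, because its quotient model
  satisfies \<open>E\<close>.\<close>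

lemma derives_if_models:
  assumes inf: "infinite (UNIV :: 'b set)" and "E \<subseteq> identities" "F \<subseteq> identities"
    and models: "\<And>T :: 'b sr_alg. comm_ai_semiring T \<Longrightarrow> (\<forall>e \<in> E. satisfies T e) \<Longrightarrow>
      (\<forall>e \<in> F. satisfies T e)"
    and D: "D \<subseteq> identities" "\<And>a b. (a, b) \<in> E \<Longrightarrow> derives D a b" and ab: "(a, b) \<in> F"
  shows "derives D a b"
proof -
  obtain T :: "'b sr_alg" where T: "comm_ai_semiring T"
    "\<And>a b. a \<in> terms \<Longrightarrow> b \<in> terms \<Longrightarrow> satisfies T (a, b) \<longleftrightarrow> derives D a b"
    using ex_model_satisfying_exactly_derivable[OF inf D(1)] by blast
  have "satisfies T e" if "e \<in> E" for e
    using that assms(2) D(2) T(2) by (cases e) (auto simp: identities_def)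
  then have "satisfies T (a, b)" using models[OF T(1)] ab by blast
  then show ?thesis using T(2) ab assms(3) by (auto simp: identities_def)
qed


section \<open>Odd cycles\<close>

lemma u_term_in_terms: "u_term n \<in> terms"
proof -
  have "{{#i, i + 1#} | i. i \<in> {1..2 * n}} = (\<lambda>i. {#i, i + 1#}) ` {1..2 * n}" by blast
  then show ?thesis by (auto simp: u_term_def terms_def words_def)
qed

lemma q_term_in_terms: "q_term n \<in> terms"
  by (auto simp: q_term_def terms_def words_def mset_set_empty_iff)

lemma size_u_term: "w \<in> u_term n \<Longrightarrow> size w = 2"
  by (auto simp: u_term_def)

text \<open>The closing edge between \<open>2 n + 1\<close> and \<open>1\<close> is also a step by one modulo \<open>2 n + 1\<close>, in the
  opposite direction to the difference of its ends.\<close>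

lemma u_term_edge_cong:
  assumes "{#x, y#} \<in> u_term n"
  shows "\<exists>d \<in> {1, -1 :: int}. (2 * int n + 1) dvd (int y - int x - d)"
proof -
  have "int y - int x = 1 \<or> int y - int x = -1 \<or> (x = 1 \<and> y = 2 * n + 1) \<or> (x = 2 * n + 1 \<and> y = 1)"
    using assms by (auto simp: u_term_def add_eq_conv_ex add_mset_eq_single)
  then consider "int y - int x - 1 = 0" | "int y - int x - (-1) = 0"
    | "int y - int x - (-1) = 2 * int n + 1" | "int y - int x - 1 = - (2 * int n + 1)"
    by fastforce
  then show ?thesis by cases (metis dvd_0_right dvd_refl dvd_minus_iff insertI1 insertI2)+
qed

text \<open>Along a walk of \<open>k\<close> steps on a cycle of length \<open>N\<close> the position changes, modulo \<open>N\<close>, by a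
  sum of \<open>k\<close> signs.\<close>

lemma walk_displacement:
  fixes h :: "nat \<Rightarrow> nat" and N :: int
  assumes "\<And>i. i < k \<Longrightarrow> \<exists>d \<in> {1, -1}. N dvd (int (h (Suc i)) - int (h i) - d)"
  shows "\<exists>z. \<bar>z\<bar> \<le> int k \<and> even (z - int k) \<and> N dvd (int (h k) - int (h 0) - z)"
  using assms
proof (induction k)
  case (Suc k)
  obtain z where z: "\<bar>z\<bar> \<le> int k" "even (z - int k)" "N dvd (int (h k) - int (h 0) - z)"
    using Suc.IH[OF Suc.prems] by auto
  obtain d where d: "d \<in> {1, -1}" "N dvd (int (h (Suc k)) - int (h k) - d)"
    using Suc.prems[of k] by blast
  have "N dvd (int (h (Suc k)) - int (h 0) - (z + d))"
    using dvd_add[OF z(3) d(2)] by (simp add: algebra_simps)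
  moreover have "\<bar>z + d\<bar> \<le> int (Suc k)" "even (z + d - int (Suc k))"
    using z(1,2) d(1) by auto
  ultimately show ?case by blast
qed auto

text \<open>A closed walk of odd length has an odd total displacement, hence a nonzero multiple of the
  length of the cycle.\<close>

lemma no_short_odd_closed_walk:
  fixes h :: "nat \<Rightarrow> nat" and N :: int
  assumes "\<And>i. i < k \<Longrightarrow> \<exists>d \<in> {1, -1}. N dvd (int (h (Suc i)) - int (h i) - d)"
    and "h k = h 0" "odd k"
  shows "N \<le> int k"
proof -
  obtain z where z: "\<bar>z\<bar> \<le> int k" "even (z - int k)" "N dvd z"
    using walk_displacement[of k N h, OF assms(1)] assms(2) by auto
  have "z \<noteq> 0" using z(2) assms(3) by auto
  then show ?thesis using dvd_imp_le_int[OF _ z(3)] z(1) by linarith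
qed

text \<open>Words of \<open>u_term n\<close> have length 2, so in a copy of \<open>u_term k\<close> inside it the extra factor is
  empty and every variable \<open>i\<close> is replaced by a sum of variables. Choosing one of them as \<open>h i\<close>
  gives a closed walk of length \<open>2 k + 1\<close> on the cycle of length \<open>2 n + 1\<close>.\<close>

lemma u_term_free_of_shorter:
  assumes "k < n"
  shows "is_free (u_term k) (u_term n)"
  unfolding is_free_def
proof (intro ballI notI)
  fix \<phi> assume \<phi>: "\<phi> \<in> hom term_alg term_alg" and sub: "subterm (\<phi> (u_term k)) (u_term n)"
  obtain p q where p: "p \<in> insert {{#}} terms" and u: "u_term n = p \<odot> \<phi> (u_term k) \<union> q"
    using sub by (auto simp: subterm_def)
  have "p \<noteq> {}" using p by (auto simp: terms_def)
  then obtain r where r: "r \<in> p" by blast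
  have var: "{{#i#}} \<in> terms" for i by (simp add: terms_def words_def)
  have "\<exists>w. w \<in> \<phi> {{#i#}} \<and> w \<noteq> {#}" for i
    using substD(1)[OF \<phi> var[of i]] by (auto simp: terms_def words_def)
  then obtain w where w: "w i \<in> \<phi> {{#i#}}" "w i \<noteq> {#}" for i by metis
  have edge: "r + (w i + w j) \<in> u_term n" if "{#i, j#} \<in> u_term k" for i j
  proof -
    have "w i + w j \<in> \<phi> {{#i#}} \<odot> \<phi> {{#j#}}" using w(1) by (auto simp: term_mult_def)
    also have "\<dots> = \<phi> {{#i, j#}}"
      using substD(3)[OF \<phi> var var, of i j] by (simp add: add_mset_commute)
    also have "\<dots> \<subseteq> \<phi> (u_term k)"
      using that by (intro subst_mono[OF \<phi> _ u_term_in_terms]) (auto simp: terms_def words_def)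
    finally show ?thesis using r by (auto simp: u term_mult_def)
  qed
  have small: "r = {#} \<and> size (w i) = 1 \<and> size (w j) = 1" if "{#i, j#} \<in> u_term k" for i j
  proof -
    have "size r + (size (w i) + size (w j)) = 2" using size_u_term[OF edge[OF that]] by simp
    moreover have "size (w i) > 0" "size (w j) > 0" using w(2) by (simp_all add: nonempty_has_size)
    ultimately have "size r = 0" "size (w i) = 1" "size (w j) = 1" by linarith+
    then show ?thesis by simp
  qed
  define g where "g i = (SOME x. w i = {#x#})" for i
  have w_eq: "w i = {#g i#}" if "size (w i) = 1" for i
    unfolding g_def using size_1_singleton_mset[OF that] by (rule someI_ex)
  have g: "{#g i, g j#} \<in> u_term n" if "{#i, j#} \<in> u_term k" for i j
  proof -
    have "w i = {#g i#}" "w j = {#g j#}" "r = {#}"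
      using small[OF that] w_eq by blast+
    then show ?thesis using edge[OF that] by (simp add: add_mset_commute)
  qed
  define h where "h i = g (if i = 2 * k + 1 then 1 else i + 1)" for i
  have "{#if i = 2 * k + 1 then 1 else i + 1, if Suc i = 2 * k + 1 then 1 else Suc i + 1#} \<in> u_term k"
    if "i < 2 * k + 1" for i
    using that by (auto simp: u_term_def)
  then have walk: "{#h i, h (Suc i)#} \<in> u_term n" if "i < 2 * k + 1" for i
    using g that unfolding h_def by blast
  have "2 * int n + 1 \<le> int (2 * k + 1)"
    by (rule no_short_odd_closed_walk[of "2 * k + 1" "2 * int n + 1" h])
      (use walk u_term_edge_cong in \<open>simp_all add: h_def\<close>)
  then show False using assms by simp
qed


section \<open>Nonfinite basis\<close>

theorem theorem3p2:
  fixes S :: "'a sr_alg" and \<Sigma> :: "identity set"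
  assumes "infinite (UNIV :: 'b set)"
    and "comm_ai_semiring S"
    and "\<Sigma> \<subseteq> inequalities"
    and "equational_basis TYPE('b) S \<Sigma>"
    and "\<exists>\<Omega>' \<subseteq> Omega. infinite \<Omega>' \<and> \<Omega>' \<subseteq> \<Sigma>"
    and "\<And>s t m. \<lbrakk>s \<in> terms; t \<in> terms; (s \<preceq> t) \<in> \<Sigma> - Omega; m \<ge> 1\<rbrakk> \<Longrightarrow> is_free t (u_term m)"
  shows "nonfinitely_based TYPE('b) S"
  unfolding nonfinitely_based_def
proof
  assume "\<exists>\<Gamma>. finite \<Gamma> \<and> equational_basis TYPE('b) S \<Gamma>"
  then obtain \<Gamma> where \<Gamma>: "finite \<Gamma>" "equational_basis TYPE('b) S \<Gamma>" by blast
  have ids: "\<Sigma> \<subseteq> identities" "\<Gamma> \<subseteq> identities"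
    using assms(4) \<Gamma>(2) by (simp_all add: equational_basis_def)
  have same_models: "(\<forall>e \<in> \<Sigma>. satisfies T e) \<longleftrightarrow> (\<forall>e \<in> \<Gamma>. satisfies T e)"
    if "comm_ai_semiring T" for T :: "'b sr_alg"
    using assms(4) \<Gamma>(2) that unfolding equational_basis_def by blast

  \<comment> \<open>Compactness: a finite part of \<open>\<Sigma>\<close> derives \<open>\<Gamma>\<close>, and hence all of \<open>\<Sigma>\<close>.\<close>
  have "derives \<Sigma> (fst e) (snd e)" if "e \<in> \<Gamma>" for e
    by (rule derives_if_models[OF assms(1) ids])
      (use same_models ids that in \<open>auto intro: derives_axiom\<close>)
  then have "\<forall>e \<in> \<Gamma>. \<exists>F \<subseteq> \<Sigma>. finite F \<and> derives F (fst e) (snd e)"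
    using derives_finite by blast
  then obtain G where G: "\<And>e. e \<in> \<Gamma> \<Longrightarrow> G e \<subseteq> \<Sigma> \<and> finite (G e) \<and> derives (G e) (fst e) (snd e)"
    by metis
  define F where "F = (\<Union>e \<in> \<Gamma>. G e)"
  have F: "finite F" "F \<subseteq> \<Sigma>" using G \<Gamma>(1) by (auto simp: F_def)
  have F_derives_\<Gamma>: "derives F a b" if "(a, b) \<in> \<Gamma>" for a b
    using G[OF that] by (auto simp: F_def intro: derives_mono that)
  have F_derives: "derives F a b" if "(a, b) \<in> \<Sigma>" for a b
    by (rule derives_if_models[OF assms(1) ids(2,1)])
      (use same_models ids F F_derives_\<Gamma> that in auto)

  \<comment> \<open>A cycle of \<open>\<Sigma>\<close> that is longer than all cycles of \<open>F\<close>.\<close>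
  have "F \<inter> Omega \<subseteq> sigma ` {1..}" by (auto simp: Omega_def)
  then obtain C where C: "finite C" "F \<inter> Omega = sigma ` C"
    using finite_subset_image[of "F \<inter> Omega" sigma "{1..}"] F(1) by auto
  obtain n where n: "sigma n \<in> \<Sigma>" "n \<ge> 1" "\<And>k. k \<in> C \<Longrightarrow> k < n"
  proof -
    obtain \<Omega>' where \<Omega>': "\<Omega>' \<subseteq> Omega" "infinite \<Omega>'" "\<Omega>' \<subseteq> \<Sigma>" using assms(5) by blast
    have "\<not> \<Omega>' \<subseteq> sigma ` {..Max (insert 0 C)}" using \<Omega>'(2) finite_surj by blast
    then obtain e where e: "e \<in> \<Omega>'" "e \<notin> sigma ` {..Max (insert 0 C)}" by blast
    then obtain n where n: "e = sigma n" "n \<ge> 1" using \<Omega>'(1) by (auto simp: Omega_def)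
    then have "Max (insert 0 C) < n" using e(2) by (auto simp: image_iff not_le)
    then have "k < n" if "k \<in> C" for k using that C(1) by simp
    moreover have "sigma n \<in> \<Sigma>" using n(1) e(1) \<Omega>'(3) by blast
    ultimately show thesis using n(2) by (intro that)
  qed

  have "\<exists>s \<in> terms. \<exists>t \<in> terms. e = (s \<preceq> t) \<and> is_free t (u_term n)" if e: "e \<in> F" for e
  proof (cases "e \<in> Omega")
    case True
    then have "e \<in> sigma ` C" using e C(2) by blast
    then obtain k where "k \<in> C" "e = sigma k" by blast
    then have "e = (q_term k \<preceq> u_term k)" "is_free (u_term k) (u_term n)"
      by (simp_all add: sigma_def u_term_free_of_shorter n(3))
    then show ?thesis using q_term_in_terms u_term_in_terms by blast
  next
    case False
    obtain s t where st: "e = (s \<preceq> t)" "s \<in> terms" "t \<in> terms"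
      using e F(2) assms(3) unfolding inequalities_def by blast
    have "e \<in> \<Sigma> - Omega" using e False F(2) by blast
    then have "is_free t (u_term n)" using assms(6)[OF st(2,3) _ n(2)] st(1) by simp
    then show ?thesis using st by blast
  qed
  moreover have "derives F (u_term n) (u_term n \<union> q_term n)"
    using F_derives n(1) by (simp add: sigma_def inequality_def)
  ultimately have "u_term n \<union> q_term n = u_term n"
    using derives_isolated by blast
  \<comment> \<open>The derived inequality is proper: the only word of \<open>q_term n\<close> has length at least 3.\<close>
  then have "mset_set {1..2 * n + 1} \<in> u_term n" by (auto simp: q_term_def)
  then show False using size_u_term[of "mset_set {1..2 * n + 1}" n] n(2) by simp
qed

end
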